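(* Let $U$ be a Hilbert space, $\mathcal{F}:U\to\mathbb{R}$ and $\mathcal{G}:U\to\mathbb{R}\cup\{\infty\}$ ($\mathcal{G}$ not necessarily convex), and assume that $\mathcal{F}$ is convex and weakly lower semicontinuous, $\mathcal{G}$ is proper and non-negative, and $\mathcal{F}+\mathcal{G}^{**}$ is radially unbounded. Then the system $$-\bar p\in\partial\mathcal{F}(\bar u),\qquad \bar u\in\partial\mathcal{G}^*(\bar p)$$ admits a solution $(\bar u,\bar p)\in U\times U$. If $\mathcal{F}$ is strictly convex, this solution is unique.
   Context: $U$ is identified with its dual. $\mathcal{G}^*:U\to\mathbb{R}\cup\{\infty\}$, $\mathcal{G}^*(p)=\sup_{u\in U}\langle u,p\rangle-\mathcal{G}(u)$, is the Fenchel conjugate of $\mathcal{G}$ and $\mathcal{G}^{**}=(\mathcal{G}^* )^*$ is its biconjugate. $\partial$ denotes the convex subdifferential. A functional $\mathcal{K}$ is radially unbounded if $\mathcal{K}(u)\to\infty$ whenever $\|u\|_U\to\infty$.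
   Formalization: For strictly convex F only ū is shown unique; p̄ is shown unique where F is Gateaux differentiable at ū. Uniqueness of the pair fails in general: U=ℝ, F(x)=|x|+x², G the indicator of {0} has solutions (0,p) for all |p|≤1. *)

theory Defs
  imports "HOL-Analysis.Analysis"
begin

text \<open>
  A real Hilbert space is a type of sort \<open>{real_inner, complete_space}\<close>; it is identified with its
  dual through the inner product. Extended-valued functionals have type \<open>'a \<Rightarrow> ereal\<close>, the
  value \<open>-\<infinity>\<close> being excluded by \<open>proper\<close>.
\<close>

definition weak_topology :: "'a::real_normed_vector topology" where
  "weak_topology =
     topology_generated_by {f -` V | f V. bounded_linear (f :: 'a \<Rightarrow> real) \<and> open V}"

definition weakly_lsc :: "('a::real_normed_vector \<Rightarrow> real) \<Rightarrow> bool" where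
  "weakly_lsc f \<longleftrightarrow> (\<forall>c. openin weak_topology {x. c < f x})"

definition strictly_convex :: "('a::real_vector \<Rightarrow> real) \<Rightarrow> bool" where
  "strictly_convex f \<longleftrightarrow>
     (\<forall>x y t. x \<noteq> y \<longrightarrow> 0 < t \<longrightarrow> t < 1 \<longrightarrow>
        f ((1 - t) *\<^sub>R x + t *\<^sub>R y) < (1 - t) * f x + t * f y)"

definition proper :: "('a \<Rightarrow> ereal) \<Rightarrow> bool" where
  "proper f \<longleftrightarrow> (\<forall>x. f x \<noteq> -\<infinity>) \<and> (\<exists>x. f x \<noteq> \<infinity>)"

definition radially_unbounded :: "('a::real_normed_vector \<Rightarrow> ereal) \<Rightarrow> bool" where
  "radially_unbounded f \<longleftrightarrow> (f \<longlongrightarrow> \<infinity>) at_infinity"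

definition fenchel_conjugate :: "('a::real_inner \<Rightarrow> ereal) \<Rightarrow> 'a \<Rightarrow> ereal" where
  "fenchel_conjugate f p = (SUP u. ereal (u \<bullet> p) - f u)"

text \<open>The subdifferential is empty at points where the functional is not finite.\<close>

definition subdifferential :: "('a::real_inner \<Rightarrow> ereal) \<Rightarrow> 'a \<Rightarrow> 'a set" where
  "subdifferential f x =
     {p. \<bar>f x\<bar> \<noteq> \<infinity> \<and> (\<forall>y. f x + ereal (p \<bullet> (y - x)) \<le> f y)}"

definition solves_system :: "('a::real_inner \<Rightarrow> real) \<Rightarrow> ('a \<Rightarrow> ereal) \<Rightarrow> 'a \<Rightarrow> 'a \<Rightarrow> bool" where
  "solves_system F G u p \<longleftrightarrow>
     - p \<in> subdifferential (\<lambda>x. ereal (F x)) u \<and> u \<in> subdifferential (fenchel_conjugate G) p"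

text \<open>
  Directional differentiability along every line; for continuous convex functionals this is Gateaux
  differentiability, since the two-sided directional derivative is then automatically linear and
  bounded in the direction. Strict convexity of \<open>F\<close> determines only the first component \<open>u\<close> of a solution
  of the system; the second is determined where \<open>F\<close> is differentiable, but not in general: take
  \<open>F x = \<bar>x\<bar> + x\<^sup>2\<close> on the reals and \<open>G\<close> the indicator function of \<open>{0}\<close>.
\<close>

definition gateaux_differentiable_at :: "('a::real_vector \<Rightarrow> real) \<Rightarrow> 'a \<Rightarrow> bool" where
  "gateaux_differentiable_at F u \<longleftrightarrow> (\<forall>h. (\<lambda>t. F (u + t *\<^sub>R h)) differentiable (at 0))"

end

theory Submission
  imports Defs
begin

text \<open>
  \<^emph>\<open>Why a solution exists.\<close> The system is the optimality condition of the convex relaxation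
  \<open>min F + G**\<close>. A convex lower semicontinuous functional that is finite everywhere is continuous
  (Baire, \<open>convex_closed_sublevels_imp_continuous\<close>), so the sublevel sets of \<open>F + G**\<close> are closed
  and convex; they are bounded by radial unboundedness. A nested sequence of such sets in a Hilbert
  space has a common point, which gives a minimiser \<open>u\<close> (\<open>coercive_convex_attains_min\<close>). At a
  minimiser the subdifferentials of \<open>F\<close> and \<open>G**\<close> contain opposite elements \<open>-p\<close> and \<open>p\<close>
  (\<open>minimiser_sum_subgradient\<close>): \<open>(p, 1)\<close> is the normal of a hyperplane between the open strict
  epigraph of \<open>F\<close> and the reflected epigraph of \<open>G**\<close>. Finally \<open>p \<in> \<partial>G**(u)\<close> turns into
  \<open>u \<in> \<partial>G*(p)\<close> using only \<open>G** \<le> G\<close> and the definition of \<open>G**\<close> as a supremum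
  (\<open>subgradient_biconjugate_imp_conjugate\<close>).

  Both the minimisation and the separation rest on a single compactness substitute,
  \<open>nested_closed_convex_Inter_nonempty\<close>, which follows from the parallelogram law. It stands in for
  weak compactness of balls and for the Hahn-Banach theorem: an open convex set and a point outside it
  are separated up to an error \<open>\<epsilon>\<close> by projection, and the sets of normalised \<open>\<epsilon>\<close>-separating vectors are
  nested, closed, convex and bounded.

  \<^emph>\<open>Why it is unique.\<close> Adding the four subgradient inequalities of two solutions \<open>(u, p)\<close> and
  \<open>(v, q)\<close> gives \<open>0 \<le> (p - q) \<bullet> (v - u)\<close> from \<open>F\<close> and the reverse from \<open>G*\<close>; strict convexity makes
  the first strict unless \<open>u = v\<close>. Where \<open>F\<close> is Gateaux differentiable, \<open>-p\<close> must be its derivative.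
\<close>

section \<open>Minimisation and separation in Hilbert spaces\<close>

lemma infdist_less_imp_dist_less:
  assumes "infdist z S < e" "S \<noteq> {}"
  shows "\<exists>x\<in>S. dist z x < e"
proof -
  have "bdd_below (dist z ` S)" by (rule bdd_belowI2[of _ 0]) simp
  then show ?thesis
    using assms by (simp add: infdist_notempty cINF_less_iff)
qed

text \<open>
  Intersecting each set with a ball slightly larger than the supremum of the distances to the origin
  keeps it nonempty and, since all remaining points have nearly minimal norm, makes the diameters tend
  to zero; completeness then yields the common point.
\<close>

lemma nested_closed_convex_Inter_nonempty:
  fixes C :: "nat \<Rightarrow> 'a::{real_inner, complete_space} set"
  assumes closed: "\<And>n. closed (C n)" and convex: "\<And>n. convex (C n)"
    and nonempty: "\<And>n. C n \<noteq> {}" and bounded: "bounded (C 0)"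
    and antimono: "\<And>m n. m \<le> n \<Longrightarrow> C n \<subseteq> C m"
  obtains a where "\<And>n. a \<in> C n"
proof -
  define d where "d n = infdist 0 (C n)" for n
  define D where "D = (SUP n. d n)"
  have d_le: "d n \<le> norm x" if "x \<in> C n" for n x
    using infdist_le[OF that, of 0] by (simp add: d_def)
  have d_nonneg: "0 \<le> d n" for n
    by (simp add: d_def infdist_nonneg)
  obtain B where B: "\<And>x. x \<in> C 0 \<Longrightarrow> norm x \<le> B"
    using bounded by (auto simp: bounded_iff)
  have "d n \<le> B" for n
  proof -
    obtain x where x: "x \<in> C n" using nonempty by blast
    then have "x \<in> C 0" using antimono[of 0 n] by auto
    with d_le[OF x] B show ?thesis by force
  qed
  then have bdd: "bdd_above (range d)" by (intro bdd_aboveI2)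
  then have d_le_D: "d n \<le> D" for n
    unfolding D_def by (intro cSUP_upper) auto
  define S where "S n = C n \<inter> cball 0 (D + 1 / (real n + 1))" for n
  have "\<exists>n. \<forall>x\<in>S n. \<forall>y\<in>S n. dist x y < e" if "0 < e" for e
  proof -
    have tendsto_d: "d \<longlonglongrightarrow> D"
      unfolding D_def
    proof (rule LIMSEQ_incseq_SUP[OF bdd])
      show "incseq d"
        unfolding incseq_def d_def by (intro allI impI infdist_mono antimono nonempty)
    qed
    have "(\<lambda>n. 1 / (real n + 1)) \<longlonglongrightarrow> 0"
      using LIMSEQ_inverse_real_of_nat by (simp add: inverse_eq_divide add.commute)
    then have "(\<lambda>n. 4 * (D + 1 / (real n + 1))\<^sup>2 - 4 * (d n)\<^sup>2) \<longlonglongrightarrow> 4 * (D + 0)\<^sup>2 - 4 * D\<^sup>2"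
      by (intro tendsto_intros tendsto_d)
    moreover have "4 * (D + 0)\<^sup>2 - 4 * D\<^sup>2 < e\<^sup>2" using that by simp
    ultimately obtain n where n: "4 * (D + 1 / (real n + 1))\<^sup>2 - 4 * (d n)\<^sup>2 < e\<^sup>2"
      using order_tendstoD(2) eventually_sequentially by (metis (lifting) order_refl)
    have "dist x y < e" if x: "x \<in> S n" and y: "y \<in> S n" for x y
    proof -
      define M where "M = D + 1 / (real n + 1)"
      have xy: "norm x \<le> M" "norm y \<le> M" using x y by (auto simp: S_def M_def)
      then have sq: "(norm x)\<^sup>2 \<le> M\<^sup>2" "(norm y)\<^sup>2 \<le> M\<^sup>2" by (auto intro: power_mono)
      have "(1/2) *\<^sub>R x + (1/2) *\<^sub>R y \<in> C n"
        using convexD[OF convex] x y by (simp add: S_def)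
      then have "d n \<le> norm ((1/2) *\<^sub>R (x + y))"
        using d_le by (simp add: scaleR_add_right)
      then have "2 * d n \<le> norm (x + y)" by simp
      then have "(2 * d n)\<^sup>2 \<le> (norm (x + y))\<^sup>2"
        by (rule power_mono) (simp add: d_nonneg)
      \<comment> \<open>The parallelogram law turns nearly minimal norms into a small distance.\<close>
      moreover have "(norm (x - y))\<^sup>2 = 2 * (norm x)\<^sup>2 + 2 * (norm y)\<^sup>2 - (norm (x + y))\<^sup>2"
        by (simp add: power2_norm_eq_inner algebra_simps inner_commute)
      ultimately have "(norm (x - y))\<^sup>2 \<le> 4 * M\<^sup>2 - 4 * (d n)\<^sup>2"
        using sq by (simp add: power_mult_distrib)
      with n have "(norm (x - y))\<^sup>2 < e\<^sup>2" by (simp add: M_def)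
      then show ?thesis
        using \<open>0 < e\<close> by (simp add: dist_norm power_less_imp_less_base)
    qed
    then show ?thesis by blast
  qed
  moreover have "S n \<noteq> {}" for n
  proof -
    have "d n < D + 1 / (real n + 1)"
      using d_le_D[of n] by (smt (verit) divide_pos_pos of_nat_0_le_iff)
    then obtain x where "x \<in> C n" "dist 0 x < D + 1 / (real n + 1)"
      using infdist_less_imp_dist_less nonempty unfolding d_def by blast
    then show ?thesis by (auto simp: S_def intro!: exI[of _ x])
  qed
  moreover have "closed (S n)" for n
    by (simp add: S_def closed closed_Int)
  moreover have "S n \<subseteq> S m" if "m \<le> n" for m n
  proof -
    have "1 / (real n + 1) \<le> 1 / (real m + 1)" using that by (simp add: frac_le)
    then show ?thesis using antimono[OF that] by (auto simp: S_def)
  qed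
  ultimately obtain a where "\<And>n. a \<in> S n"
    using decreasing_closed_nest[of S] by blast
  then show ?thesis using that by (auto simp: S_def)
qed

lemma nearest_point_exists:
  fixes S :: "'a::{real_inner, complete_space} set"
  assumes "closed S" "convex S" "S \<noteq> {}"
  obtains a where "a \<in> S" "\<And>x. x \<in> S \<Longrightarrow> dist z a \<le> dist z x"
proof -
  define C where "C n = S \<inter> cball z (infdist z S + 1 / (real n + 1))" for n
  have "C n \<noteq> {}" for n
  proof -
    have "infdist z S < infdist z S + 1 / (real n + 1)" by simp
    then obtain x where "x \<in> S" "dist z x < infdist z S + 1 / (real n + 1)"
      using infdist_less_imp_dist_less assms(3) by blast
    then show ?thesis by (auto simp: C_def intro!: exI[of _ x])
  qed
  moreover have "C n \<subseteq> C m" if "m \<le> n" for m n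
  proof -
    have "1 / (real n + 1) \<le> 1 / (real m + 1)" using that by (simp add: frac_le)
    then show ?thesis by (auto simp: C_def)
  qed
  moreover have "closed (C n)" "convex (C n)" "bounded (C n)" for n
    using assms by (simp_all add: C_def closed_Int convex_Int bounded_Int)
  ultimately obtain a where a: "\<And>n. a \<in> C n"
    using nested_closed_convex_Inter_nonempty[of C] by blast
  have "(\<lambda>n. infdist z S + 1 / (real n + 1)) \<longlonglongrightarrow> infdist z S + 0"
    using LIMSEQ_inverse_real_of_nat
    by (intro tendsto_intros) (simp add: inverse_eq_divide add.commute)
  then have "dist z a \<le> infdist z S"
    using a by (intro LIMSEQ_le_const[where X = "\<lambda>n. infdist z S + 1 / (real n + 1)"])
      (auto simp: C_def)
  then show ?thesis
    using that[of a] a[of 0] infdist_le[of _ S z] by (force simp: C_def)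
qed

text \<open>
  The infimum may be \<open>-\<infinity>\<close> a priori: the sublevel sets along any minimising sequence of values still
  have a common point, and it attains the infimum.
\<close>

lemma coercive_convex_attains_min:
  fixes J :: "'a::{real_inner, complete_space} \<Rightarrow> ereal"
  assumes closed: "\<And>c. closed {x. J x \<le> ereal c}"
    and convex: "\<And>c. convex {x. J x \<le> ereal c}"
    and bounded: "\<And>c. bounded {x. J x \<le> ereal c}"
    and not_minus_infinity: "\<And>x. J x \<noteq> -\<infinity>"
  obtains u where "\<And>x. J u \<le> J x"
proof (cases "\<exists>x. J x \<noteq> \<infinity>")
  case False
  then show ?thesis by (intro that) simp
next
  case True
  define A where "A = J ` {x. J x \<noteq> \<infinity>}"
  have "A \<noteq> {}" using True by (auto simp: A_def)
  then obtain f :: "nat \<Rightarrow> ereal" where f: "decseq f" "range f \<subseteq> A" "Inf A = (INF n. f n)"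
    using Inf_countable_INF[OF \<open>A \<noteq> {}\<close>] by blast
  have finite: "f n = ereal (real_of_ereal (f n))" for n
  proof -
    have "f n \<in> A" using f(2) by auto
    then have "\<bar>f n\<bar> \<noteq> \<infinity>" using not_minus_infinity by (fastforce simp: A_def)
    then show ?thesis by (simp add: ereal_real)
  qed
  define C where "C n = {x. J x \<le> f n}" for n
  have C: "C n = {x. J x \<le> ereal (real_of_ereal (f n))}" for n
    using finite[of n] by (simp add: C_def)
  have "C n \<noteq> {}" for n
  proof -
    have "f n \<in> A" using f(2) by auto
    then show ?thesis by (auto simp: A_def C_def)
  qed
  moreover have "C n \<subseteq> C m" if "m \<le> n" for m n
    using decseqD[OF f(1) that] by (auto simp: C_def)
  ultimately obtain u where u: "\<And>n. u \<in> C n"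
    using nested_closed_convex_Inter_nonempty[of C] closed convex bounded C by metis
  then have "J u \<le> Inf A"
    unfolding f(3) by (intro INF_greatest) (simp add: C_def)
  then have "J u \<le> J x" for x
    by (cases "J x = \<infinity>") (auto simp: A_def intro: order_trans INF_lower)
  then show ?thesis using that by blast
qed

text \<open>
  Separation of an open convex set from a point in a Hilbert space. The origin may lie on the boundary
  of \<open>C\<close>, where projecting it gives nothing. But \<open>- \<epsilon> *\<^sub>R c\<close> has positive distance from \<open>C\<close>, since
  otherwise the origin would lie on a segment from a point of \<open>C\<close> to a point of the ball around \<open>c\<close>.
  Projecting \<open>- \<epsilon> *\<^sub>R c\<close> gives a vector that separates up to \<open>\<epsilon>\<close>. The normalisation
  \<open>p \<bullet> c = 1\<close> keeps these vectors bounded and away from zero, so the limit \<open>\<epsilon> \<rightarrow> 0\<close> is an instance of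
  the nested intersection property.
\<close>

lemma separate_zero_open_convex:
  fixes C :: "'a::{real_inner, complete_space} set"
  assumes "open C" "convex C" "0 \<notin> C" "c \<in> C"
  obtains p where "p \<bullet> c = 1" "\<And>x. x \<in> C \<Longrightarrow> 0 \<le> p \<bullet> x"
proof -
  define e where "e n = 1 / (real n + 1)" for n
  have e_pos: "0 < e n" for n by (simp add: e_def)
  define P where "P n = {p. p \<bullet> c = 1} \<inter> (\<Inter>x\<in>C. {p. - e n \<le> p \<bullet> x})" for n
  obtain r where "0 < r" and r: "cball c r \<subseteq> C"
    using \<open>open C\<close> \<open>c \<in> C\<close> open_contains_cball by blast
  have "closed (P n)" for n
    unfolding P_def by (intro closed_Int closed_INT ballI closed_Collect_eq closed_Collect_le
        continuous_intros)
  moreover have "convex (P n)" for n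
  proof -
    have "convex {p. p \<bullet> c = 1}" "convex {p. - e n \<le> p \<bullet> x}" for x
      using convex_hyperplane[where a = c and b = 1] convex_halfspace_ge[where a = x and b = "- e n"]
      by (simp_all add: inner_commute)
    then show ?thesis unfolding P_def by (intro convex_Int convex_INT)
  qed
  moreover have "P n \<noteq> {}" for n
  proof -
    have "- e n *\<^sub>R c \<notin> closure C"
    proof
      assume "- e n *\<^sub>R c \<in> closure C"
      then obtain y where y: "y \<in> C" "dist y (- e n *\<^sub>R c) < e n * r"
        using e_pos \<open>0 < r\<close> closure_approachable by (metis mult_pos_pos)
      \<comment> \<open>\<open>w\<close> is close to \<open>c\<close>, and the origin lies between \<open>y\<close> and \<open>w\<close>.\<close>
      define w where "w = - (1 / e n) *\<^sub>R y"
      have "c - w = (1 / e n) *\<^sub>R (y - (- e n *\<^sub>R c))"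
        using e_pos[of n] by (simp add: w_def scaleR_add_right)
      then have "dist c w = (1 / e n) * dist y (- e n *\<^sub>R c)"
        using e_pos[of n] by (simp add: dist_norm)
      also have "\<dots> \<le> r" using y(2) e_pos[of n] by (simp add: field_simps)
      finally have "w \<in> C" using r by auto
      then have "(1 / (1 + e n)) *\<^sub>R y + (e n / (1 + e n)) *\<^sub>R w \<in> C"
        using e_pos[of n] y(1) by (intro convexD[OF \<open>convex C\<close>]) (auto simp: field_simps)
      moreover have "(1 / (1 + e n)) *\<^sub>R y + (e n / (1 + e n)) *\<^sub>R w = 0"
        using e_pos[of n] by (simp add: w_def)
      ultimately show False using \<open>0 \<notin> C\<close> by simp
    qed
    obtain a where a: "a \<in> closure C"
      and near: "\<And>x. x \<in> closure C \<Longrightarrow> dist (- e n *\<^sub>R c) a \<le> dist (- e n *\<^sub>R c) x"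
      using nearest_point_exists[of "closure C" "- e n *\<^sub>R c"] \<open>convex C\<close> \<open>c \<in> C\<close>
        convex_closure closure_subset closed_closure by (metis closure_eq_empty empty_iff)
    define q where "q = a + e n *\<^sub>R c"
    have "q \<noteq> 0"
      using a \<open>- e n *\<^sub>R c \<notin> closure C\<close> by (auto simp: q_def eq_neg_iff_add_eq_0[symmetric])
    then have "0 < q \<bullet> q" by simp
    have q: "- e n * (q \<bullet> c) < q \<bullet> x" if "x \<in> C" for x
    proof -
      have "x \<in> closure C" using that closure_subset by blast
      then have "(- e n *\<^sub>R c - a) \<bullet> (x - a) \<le> 0"
        using any_closest_point_dot[of "closure C" a x "- e n *\<^sub>R c"] near a \<open>convex C\<close>
        by (simp add: convex_closure)
      then have "q \<bullet> a \<le> q \<bullet> x"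
        by (simp add: q_def algebra_simps)
      moreover have "q \<bullet> a = q \<bullet> q - e n * (q \<bullet> c)"
        by (simp add: q_def algebra_simps inner_commute)
      ultimately show ?thesis using \<open>0 < q \<bullet> q\<close> by linarith
    qed
    have "0 < (1 + e n) * (q \<bullet> c)" using q[OF \<open>c \<in> C\<close>] by (simp add: algebra_simps)
    then have qc: "0 < q \<bullet> c" using e_pos[of n] by (simp add: zero_less_mult_iff)
    have "(1 / (q \<bullet> c)) *\<^sub>R q \<in> P n"
      using qc q by (auto simp: P_def field_simps intro: less_imp_le)
    then show ?thesis by blast
  qed
  moreover have "bounded (P 0)"
    unfolding bounded_iff
  proof (intro exI ballI)
    fix p assume p: "p \<in> P 0"
    show "norm p \<le> 2 / r"
    proof (cases "p = 0")
      case False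
      \<comment> \<open>The point of the ball around \<open>c\<close> at which \<open>p\<close> is smallest.\<close>
      define x where "x = c - (r / norm p) *\<^sub>R p"
      have "x \<in> C" using r \<open>0 < r\<close> False by (auto simp: x_def dist_norm)
      then have "- 1 \<le> p \<bullet> x" using p by (auto simp: P_def e_def)
      also have "p \<bullet> x = 1 - r * norm p"
        using p False
        by (simp add: x_def P_def inner_diff_right power2_norm_eq_inner[symmetric] power2_eq_square)
      finally show ?thesis using \<open>0 < r\<close> by (simp add: field_simps)
    qed (use \<open>0 < r\<close> in simp)
  qed
  moreover have "P n \<subseteq> P m" if "m \<le> n" for m n
  proof -
    have "e n \<le> e m" using that by (simp add: e_def frac_le)
    then show ?thesis by (force simp: P_def)
  qed
  ultimately obtain p where p: "\<And>n. p \<in> P n"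
    using nested_closed_convex_Inter_nonempty[of P] by blast
  have "0 \<le> p \<bullet> x" if "x \<in> C" for x
  proof -
    have "(\<lambda>n. - e n) \<longlonglongrightarrow> - 0"
      using LIMSEQ_inverse_real_of_nat
      by (intro tendsto_intros) (simp add: e_def inverse_eq_divide add.commute)
    then have "- 0 \<le> p \<bullet> x"
      by (rule LIMSEQ_le_const2) (use p that in \<open>auto simp: P_def\<close>)
    then show ?thesis by simp
  qed
  moreover have "p \<bullet> c = 1" using p[of 0] by (simp add: P_def)
  ultimately show ?thesis using that by blast
qed

section \<open>Continuity of lower semicontinuous convex functionals\<close>

lemma convex_on_sublevel:
  assumes F: "convex_on UNIV F"
  shows "convex {x. F x \<le> c}"
proof (rule convexI, simp)
  fix x y and a b :: real
  assume "F x \<le> c" "F y \<le> c" and ab: "0 \<le> a" "0 \<le> b" "a + b = 1"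
  have "F (a *\<^sub>R x + b *\<^sub>R y) \<le> a * F x + b * F y"
    using F ab by (simp add: convex_on_def)
  also have "\<dots> \<le> a * c + b * c"
    using \<open>F x \<le> c\<close> \<open>F y \<le> c\<close> ab by (intro add_mono mult_left_mono) auto
  also have "\<dots> = c" using ab by (simp flip: distrib_right)
  finally show "F (a *\<^sub>R x + b *\<^sub>R y) \<le> c" .
qed

lemma openin_weak_topology_imp_open:
  assumes "openin weak_topology S"
  shows "open S"
proof -
  have "generate_topology_on {f -` V | f V. bounded_linear (f :: 'a \<Rightarrow> real) \<and> open V} S"
    using assms by (simp add: weak_topology_def openin_topology_generated_by_iff)
  then show ?thesis
  proof induction
    case (Basis s)
    then show ?case
      by (auto intro!: open_vimage linear_continuous_on)
  qed auto
qed

lemma closed_sublevel_weakly_lsc: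
  assumes "weakly_lsc F"
  shows "closed {x. F x \<le> c}"
proof -
  have "open {x. c < F x}"
    using assms openin_weak_topology_imp_open by (auto simp: weakly_lsc_def)
  then show ?thesis by (simp add: closed_def Compl_eq not_le)
qed

text \<open>
  By Baire's theorem one of countably many closed sublevel sets contains a ball, and a convex functional
  that is bounded above near a point is continuous there. Working with the symmetric sets \<open>E n\<close> around
  an arbitrary point \<open>x0\<close> moves the ball to \<open>x0\<close> itself: a convex set that is symmetric about the origin
  and contains a ball contains the ball of the same radius around the origin.
\<close>

lemma convex_closed_sublevels_imp_continuous:
  fixes F :: "'a::{real_normed_vector, complete_space} \<Rightarrow> real"
  assumes F: "convex_on UNIV F" and closed: "\<And>c. closed {x. F x \<le> c}"
  shows "continuous_on UNIV F"
proof -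
  have "isCont F x0" for x0
  proof -
    define E where "E n = {h. F (x0 + h) \<le> real n \<and> F (x0 - h) \<le> real n}" for n :: nat
    have cl: "closed (E n)" for n
    proof -
      have "E n = (\<lambda>h. x0 + h) -` {x. F x \<le> real n} \<inter> (\<lambda>h. x0 - h) -` {x. F x \<le> real n}"
        by (auto simp: E_def)
      moreover have "closed ((\<lambda>h. x0 + h) -` {x. F x \<le> real n})"
          "closed ((\<lambda>h. x0 - h) -` {x. F x \<le> real n})"
        by (intro closed_vimage closed continuous_intros)+
      ultimately show ?thesis by (simp add: closed_Int)
    qed
    have sublevel: "convex {x. F x \<le> real n}" for n
      using convex_on_sublevel[OF F] by simp
    have cv: "convex (E n)" for n
    proof (rule convexI)
      fix x y and a b :: real
      assume xy: "x \<in> E n" "y \<in> E n" and ab: "0 \<le> a" "0 \<le> b" "a + b = 1"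
      have x0: "x0 = a *\<^sub>R x0 + b *\<^sub>R x0" using ab by (simp flip: scaleR_add_left)
      have "x0 + (a *\<^sub>R x + b *\<^sub>R y) = a *\<^sub>R (x0 + x) + b *\<^sub>R (x0 + y)"
          "x0 - (a *\<^sub>R x + b *\<^sub>R y) = a *\<^sub>R (x0 - x) + b *\<^sub>R (x0 - y)"
        by (subst x0, simp add: algebra_simps)+
      then show "a *\<^sub>R x + b *\<^sub>R y \<in> E n"
        using xy convexD[OF sublevel _ _ ab] by (auto simp: E_def)
    qed
    have "(\<Union>n. E n) = UNIV"
    proof -
      have "\<exists>n. h \<in> E n" for h
        using real_arch_simple[of "max (F (x0 + h)) (F (x0 - h))"] by (auto simp: E_def)
      then show ?thesis by blast
    qed
    then have "interior (\<Union>(range E)) \<noteq> {}" by simp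
    then obtain n where "interior (E n) \<noteq> {}"
      using Baire_category_alt[of "euclidean :: 'a topology" "range E"] cl
        completely_metrizable_space_euclidean[where 'a = 'a]
      by auto
    then obtain h r where "0 < r" and r: "ball h r \<subseteq> E n"
      by (meson all_not_in_conv mem_interior)
    have symm: "- h \<in> E n" if "h \<in> E n" for h
      using that by (auto simp: E_def)
    have ball0: "ball 0 r \<subseteq> E n"
    proof
      fix z assume z: "z \<in> ball (0::'a) r"
      have "h + z \<in> ball h r" "h - z \<in> ball h r"
        using z by (simp_all add: dist_norm)
      then have "h + z \<in> E n" "- (h - z) \<in> E n"
        using r symm by blast+
      then have "(1/2) *\<^sub>R (h + z) + (1/2) *\<^sub>R (- (h - z)) \<in> E n"
        by (intro convexD[OF cv]) auto
      moreover have "(1/2) *\<^sub>R (h + z) + (1/2) *\<^sub>R (- (h - z)) = z"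
        by (simp add: algebra_simps flip: scaleR_add_left)
      ultimately show "z \<in> E n" by simp
    qed
    have bound: "F y \<le> real n" if "y \<in> cball x0 (r/2)" for y
    proof -
      have "y - x0 \<in> E n"
        using that ball0 \<open>0 < r\<close> by (auto simp: dist_norm norm_minus_commute subset_eq)
      then show ?thesis by (simp add: E_def)
    qed
    have "continuous_on (ball x0 (r/2)) F"
    proof (rule convex_on_bounded_continuous)
      show "convex_on (ball x0 (r/2)) F" using convex_on_subset[OF F] by auto
      show "\<forall>x\<in>ball x0 (r/2). \<bar>F x\<bar> \<le> real n + 2 * \<bar>F x0\<bar>"
        using convex_bounds_lemma[of x0 "r/2" F "real n"] bound convex_on_subset[OF F] by auto
    qed simp
    then show ?thesis
      using \<open>0 < r\<close> by (simp add: continuous_on_eq_continuous_at)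
  qed
  then show ?thesis by (simp add: continuous_at_imp_continuous_on)
qed

section \<open>A subgradient sum rule\<close>

text \<open>
  \<open>D\<close> is the set of differences between points of the strict epigraph of \<open>F\<close> and points of the
  hypograph of \<open>F u + g u - g\<close>; minimality of \<open>u\<close> says that these are disjoint, so \<open>0 \<notin> D\<close>.
  Continuity of \<open>F\<close> makes \<open>D\<close> open. Since \<open>(0, 1) \<in> D\<close>, the separating vector can be normalised to
  have last component \<open>1\<close>, so that the hyperplane is not vertical.
\<close>

lemma minimiser_sum_subgradient:
  fixes F :: "'a::{real_inner, complete_space} \<Rightarrow> real" and g :: "'a \<Rightarrow> ereal"
  assumes F: "convex_on UNIV F" "continuous_on UNIV F"
    and g: "convex {(y, t). g y \<le> ereal t}"
    and fin: "\<bar>g u\<bar> \<noteq> \<infinity>"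
    and min: "\<And>x. ereal (F u) + g u \<le> ereal (F x) + g x"
  obtains p where "- p \<in> subdifferential (\<lambda>x. ereal (F x)) u" "p \<in> subdifferential g u"
proof -
  obtain gu where gu: "g u = ereal gu" using fin by (cases "g u") auto
  define A where "A = {(x, s). F x < s}"
  define B where "B = (\<lambda>w. (- fst w, snd w - F u - gu)) ` {(y, t). g y \<le> ereal t}"
  define D where "D = (\<Union>a\<in>A. \<Union>b\<in>B. {a + b})"
  have "open A"
  proof -
    have "A = {w. F (fst w) < snd w}" by (auto simp: A_def)
    moreover have "continuous_on UNIV (\<lambda>w::'a \<times> real. F (fst w))"
      by (rule continuous_on_compose2[OF F(2)]) (auto intro: continuous_intros)
    ultimately show ?thesis by (auto intro!: open_Collect_less continuous_intros)
  qed
  then have "open D" unfolding D_def by (intro open_sums) simp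
  have "convex A"
  proof (rule convexI, clarsimp simp: A_def)
    fix x s y t and a b :: real
    assume xs: "F x < s" "F y < t" and ab: "0 \<le> a" "0 \<le> b" "a + b = 1"
    have "F (a *\<^sub>R x + b *\<^sub>R y) \<le> a * F x + b * F y"
      using F(1) ab by (simp add: convex_on_def)
    also have "\<dots> < a * s + b * t"
      using xs ab by (metis add_cancel_left_left add_less_le_mono add_le_less_mono less_eq_real_def
          mult_left_mono mult_strict_left_mono mult_zero_left zero_neq_one)
    finally show "F (a *\<^sub>R x + b *\<^sub>R y) < a * s + b * t" .
  qed
  moreover have "convex B"
  proof -
    have "linear (\<lambda>w::'a \<times> real. (- fst w, snd w))"
      by (auto intro!: linearI)
    then have "convex ((\<lambda>w. (0, - F u - gu) + w) ` (\<lambda>w. (- fst w, snd w)) ` {(y, t). g y \<le> ereal t})"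
      using g by (intro convex_translation convex_linear_image)
    also have "\<dots> = B" by (simp add: B_def image_image algebra_simps)
    finally show ?thesis .
  qed
  ultimately have "convex D" unfolding D_def by (rule convex_sums)
  have DI: "(x - y, s + t - F u - gu) \<in> D" if "F x < s" "g y \<le> ereal t" for x y s t
    unfolding D_def A_def B_def using that by (force simp: image_iff)
  have "0 \<notin> D"
  proof
    assume "0 \<in> D"
    then obtain x s t where "F x < s" "g x \<le> ereal t" "s + t = F u + gu"
      by (auto simp: D_def A_def B_def zero_prod_def)
    then have "ereal (F x) + g x \<le> ereal (F x + t)"
      using add_left_mono[of "g x" "ereal t" "ereal (F x)"] by simp
    also have "\<dots> < ereal (F u) + g u" using \<open>F x < s\<close> \<open>s + t = F u + gu\<close> gu by simp
    finally show False using min[of x] by simp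
  qed
  have c: "(0, 1) \<in> D" using DI[of u "F u + 1" u gu] gu by simp
  obtain w where "w \<bullet> (0, 1) = 1" and w: "\<And>x. x \<in> D \<Longrightarrow> 0 \<le> w \<bullet> x"
    using separate_zero_open_convex[OF \<open>open D\<close> \<open>convex D\<close> \<open>0 \<notin> D\<close> c] by blast
  then obtain p where wp: "w = (p, 1)" by (cases w) auto
  \<comment> \<open>Setting \<open>y = u\<close> below gives the subgradient of \<open>F\<close>, setting \<open>x = u\<close> that of \<open>g\<close>.\<close>
  have key: "F u + gu \<le> p \<bullet> (x - y) + F x + t" if "g y \<le> ereal t" for x y t
  proof (rule field_le_epsilon)
    fix e :: real assume "0 < e"
    then show "F u + gu \<le> p \<bullet> (x - y) + F x + t + e"
      using w[OF DI[of x "F x + e" y t]] that by (simp add: wp)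
  qed
  have "- p \<in> subdifferential (\<lambda>x. ereal (F x)) u"
    using key[of u gu] gu by (auto simp: subdifferential_def inner_diff_right algebra_simps)
  moreover have "p \<in> subdifferential g u"
  proof -
    have "g u + ereal (p \<bullet> (y - u)) \<le> g y" for y
    proof (rule ereal_le_real)
      fix t assume "g y \<le> ereal t"
      then show "g u + ereal (p \<bullet> (y - u)) \<le> ereal t"
        using key[of y t u] by (simp add: gu inner_diff_right)
    qed
    then show ?thesis using fin by (simp add: subdifferential_def)
  qed
  ultimately show ?thesis using that by blast
qed

section \<open>Fenchel conjugates\<close>

lemma fenchel_conjugate_not_minus_infinity:
  assumes "proper G"
  shows "fenchel_conjugate G p \<noteq> -\<infinity>"
proof -
  obtain x r where "G x = ereal r"
    using assms unfolding proper_def by (metis ereal_cases)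
  then have "ereal (x \<bullet> p - r) \<le> fenchel_conjugate G p"
    unfolding fenchel_conjugate_def by (intro SUP_upper2[of x]) auto
  then show ?thesis by auto
qed

text \<open>
  The epigraph of a conjugate is an intersection of half-spaces indexed by the finite values of \<open>H\<close>.
  Its convexity, and closedness and convexity of the sublevel sets of \<open>F + H*\<close>, follow from this
  description in terms of real numbers.
\<close>

lemma fenchel_conjugate_le_iff:
  assumes "\<And>y. H y \<noteq> -\<infinity>"
  shows "fenchel_conjugate H u \<le> ereal t \<longleftrightarrow> (\<forall>(y, r)\<in>{(y, r). H y = ereal r}. u \<bullet> y - r \<le> t)"
proof -
  have "ereal (y \<bullet> u) - H y \<le> ereal t \<longleftrightarrow> (\<forall>r. H y = ereal r \<longrightarrow> u \<bullet> y - r \<le> t)" for y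
    using assms[of y] by (cases "H y") (auto simp: inner_commute)
  then show ?thesis by (auto simp: fenchel_conjugate_def SUP_le_iff)
qed

lemma convex_epigraph_fenchel_conjugate:
  assumes "\<And>y. H y \<noteq> -\<infinity>"
  shows "convex {(u, t). fenchel_conjugate H u \<le> ereal t}"
proof -
  have "{(u, t). fenchel_conjugate H u \<le> ereal t} =
      (\<Inter>(y, r)\<in>{(y, r). H y = ereal r}. {w. (y, - 1) \<bullet> w \<le> r})"
    by (auto simp: fenchel_conjugate_le_iff[OF assms] inner_commute algebra_simps)
  then show ?thesis by (auto intro!: convex_INT convex_halfspace_le)
qed

lemma sum_fenchel_conjugate_sublevel:
  fixes F :: "'a::real_inner \<Rightarrow> real"
  assumes "\<And>y. H y \<noteq> -\<infinity>"
  shows "{x. ereal (F x) + fenchel_conjugate H x \<le> ereal c} =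
    (\<Inter>(y, r)\<in>{(y, r). H y = ereal r}. {x. F x + x \<bullet> y \<le> c + r})"
proof -
  have "ereal (F x) + fenchel_conjugate H x \<le> ereal c \<longleftrightarrow> fenchel_conjugate H x \<le> ereal (c - F x)" for x
    by (cases "fenchel_conjugate H x") auto
  then show ?thesis by (auto simp: fenchel_conjugate_le_iff[OF assms] algebra_simps)
qed

lemma closed_sublevel_sum_fenchel_conjugate:
  fixes F :: "'a::real_inner \<Rightarrow> real"
  assumes "\<And>y. H y \<noteq> -\<infinity>" and "continuous_on UNIV F"
  shows "closed {x. ereal (F x) + fenchel_conjugate H x \<le> ereal c}"
  unfolding sum_fenchel_conjugate_sublevel[OF assms(1)]
  by (auto intro!: closed_INT closed_Collect_le continuous_intros assms(2))

lemma convex_sublevel_sum_fenchel_conjugate: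
  fixes F :: "'a::real_inner \<Rightarrow> real"
  assumes "\<And>y. H y \<noteq> -\<infinity>" and "convex_on UNIV F"
  shows "convex {x. ereal (F x) + fenchel_conjugate H x \<le> ereal c}"
proof -
  have "convex {x. F x + x \<bullet> y \<le> b}" for y b
  proof -
    have "convex_on UNIV (\<lambda>x. x \<bullet> y)"
      by (auto intro!: convex_onI simp: inner_add_left)
    then have "convex_on UNIV (\<lambda>x. F x + x \<bullet> y)" using assms(2) by (rule convex_on_add[rotated])
    then show ?thesis using convex_on_sublevel by fastforce
  qed
  then show ?thesis
    unfolding sum_fenchel_conjugate_sublevel[OF assms(1)] by (auto intro!: convex_INT)
qed

lemma fenchel_biconjugate_le:
  assumes "\<And>x. G x \<noteq> -\<infinity>"
  shows "fenchel_conjugate (fenchel_conjugate G) u \<le> G u"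
  unfolding fenchel_conjugate_def[of "fenchel_conjugate G"]
proof (rule SUP_least)
  fix p
  have "ereal (u \<bullet> p) - G u \<le> fenchel_conjugate G p"
    unfolding fenchel_conjugate_def by (rule SUP_upper) simp
  then show "ereal (p \<bullet> u) - fenchel_conjugate G p \<le> G u"
    using assms[of u]
    by (cases "G u"; cases "fenchel_conjugate G p") (auto simp: inner_commute algebra_simps)
qed

lemma fenchel_biconjugate_nonneg:
  assumes "\<And>x. 0 \<le> G x"
  shows "0 \<le> fenchel_conjugate (fenchel_conjugate G) u"
proof -
  have "fenchel_conjugate G 0 \<le> 0"
    unfolding fenchel_conjugate_def 
  proof (rule SUP_least)
    show "ereal (x \<bullet> 0) - G x \<le> 0" for x
      using assms[of x] by (cases "G x") auto
  qed
  then have "0 \<le> ereal (0 \<bullet> u) - fenchel_conjugate G 0"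
    by (cases "fenchel_conjugate G 0") auto
  also have "\<dots> \<le> fenchel_conjugate (fenchel_conjugate G) u"
    unfolding fenchel_conjugate_def[of "fenchel_conjugate G"] by (rule SUP_upper) simp
  finally show ?thesis .
qed

text \<open>
  With \<open>G** \<le> G\<close>, the subgradient inequality at \<open>u\<close> gives \<open>G*(p) \<le> p \<bullet> u - G**(u)\<close>, and
  \<open>u \<bullet> y - G*(y) \<le> G**(u)\<close> holds for every \<open>y\<close>; together these are the subgradient inequality of \<open>G*\<close>
  at \<open>p\<close>.
\<close>

lemma subgradient_biconjugate_imp_conjugate:
  assumes G: "proper G"
    and p: "p \<in> subdifferential (fenchel_conjugate (fenchel_conjugate G)) u"
  shows "u \<in> subdifferential (fenchel_conjugate G) p"
proof -
  let ?G1 = "fenchel_conjugate G" and ?G2 = "fenchel_conjugate (fenchel_conjugate G)"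
  obtain b where b: "?G2 u = ereal b"
    using p by (cases "?G2 u") (auto simp: subdifferential_def)
  have upper: "?G1 p \<le> ereal (p \<bullet> u - b)"
    unfolding fenchel_conjugate_def[of G]
  proof (rule SUP_least)
    fix x
    have "ereal b + ereal (p \<bullet> (x - u)) \<le> ?G2 x"
      using p b by (auto simp: subdifferential_def)
    also have "\<dots> \<le> G x" using G by (intro fenchel_biconjugate_le) (simp add: proper_def)
    finally show "ereal (x \<bullet> p) - G x \<le> ereal (p \<bullet> u - b)"
      by (cases "G x") (auto simp: inner_commute algebra_simps)
  qed
  then obtain a where a: "?G1 p = ereal a" "a \<le> p \<bullet> u - b"
    using fenchel_conjugate_not_minus_infinity[OF G, of p] by (cases "?G1 p") auto
  have "ereal a + ereal (u \<bullet> (y - p)) \<le> ?G1 y" for y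
  proof -
    have "ereal (y \<bullet> u) - ?G1 y \<le> ereal b"
      unfolding b[symmetric] fenchel_conjugate_def[of ?G1] by (rule SUP_upper) simp
    then show ?thesis
      using a(2) fenchel_conjugate_not_minus_infinity[OF G, of y]
      by (cases "?G1 y") (auto simp: inner_commute algebra_simps)
  qed
  then show ?thesis by (simp add: subdifferential_def a(1))
qed

section \<open>Existence and uniqueness\<close>

lemma solves_system_exists:
  fixes F :: "'a::{real_inner, complete_space} \<Rightarrow> real"
  assumes F: "convex_on UNIV F" "weakly_lsc F"
    and G: "proper G" "\<And>u. 0 \<le> G u"
    and unbounded: "radially_unbounded (\<lambda>u. ereal (F u) + fenchel_conjugate (fenchel_conjugate G) u)"
  shows "\<exists>u p. solves_system F G u p"
proof -
  let ?g = "fenchel_conjugate (fenchel_conjugate G)"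
  let ?J = "\<lambda>u. ereal (F u) + ?g u"
  note conj = fenchel_conjugate_not_minus_infinity[OF G(1)]
  have cont: "continuous_on UNIV F"
    using convex_closed_sublevels_imp_continuous[OF F(1)] closed_sublevel_weakly_lsc[OF F(2)] by blast
  have nonneg: "0 \<le> ?g u" for u
    using fenchel_biconjugate_nonneg[OF G(2)] .
  have "bounded {x. ?J x \<le> ereal c}" for c
  proof -
    have "\<forall>\<^sub>F x in at_infinity. ereal c < ?J x"
      using unbounded order_tendstoD(1) by (fastforce simp: radially_unbounded_def)
    then obtain b where b: "\<And>x. b \<le> norm x \<Longrightarrow> ereal c < ?J x"
      by (auto simp: eventually_at_infinity)
    then have "norm x \<le> b" if "?J x \<le> ereal c" for x
      using that by (meson linear not_le)
    then show ?thesis by (auto simp: bounded_iff)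
  qed
  moreover have "?J x \<noteq> -\<infinity>" for x
    using nonneg[of x] by auto
  ultimately obtain u where u: "\<And>x. ?J u \<le> ?J x"
    using coercive_convex_attains_min[of ?J]
      closed_sublevel_sum_fenchel_conjugate[of "fenchel_conjugate G", OF conj cont]
      convex_sublevel_sum_fenchel_conjugate[of "fenchel_conjugate G", OF conj F(1)] by blast
  obtain x where "G x \<noteq> \<infinity>" using G(1) by (auto simp: proper_def)
  then have "?g x \<noteq> \<infinity>"
    using fenchel_biconjugate_le[of G x] G(1) by (auto simp: proper_def)
  then have "?g u \<noteq> \<infinity>" using u[of x] by auto
  then have fin: "\<bar>?g u\<bar> \<noteq> \<infinity>" using nonneg[of u] by auto
  obtain p where p: "- p \<in> subdifferential (\<lambda>x. ereal (F x)) u" "p \<in> subdifferential ?g u"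
    by (rule minimiser_sum_subgradient[OF F(1) cont
          convex_epigraph_fenchel_conjugate[of "fenchel_conjugate G", OF conj] fin u])
  then have "solves_system F G u p"
    using subgradient_biconjugate_imp_conjugate[OF G(1)] by (simp add: solves_system_def)
  then show ?thesis by blast
qed

text \<open>
  The subgradient inequality at the midpoint of \<open>u\<close> and \<open>v\<close> becomes strict when combined with strict
  convexity.
\<close>

lemma strictly_convex_subgradient_less:
  assumes F: "strictly_convex F" and q: "q \<in> subdifferential (\<lambda>x. ereal (F x)) u" and "v \<noteq> u"
  shows "F u + q \<bullet> (v - u) < F v"
proof -
  let ?m = "(1 - 1/2) *\<^sub>R u + (1/2) *\<^sub>R v"
  have "?m - u = (1/2) *\<^sub>R (v - u)"
    by (simp add: algebra_simps flip: scaleR_add_left)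
  then have "F u + (1/2) * (q \<bullet> (v - u)) \<le> F ?m"
    using q by (auto simp: subdifferential_def dest: spec[of _ ?m])
  also have "\<dots> < (1 - 1/2) * F u + (1/2) * F v"
    using F[unfolded strictly_convex_def, rule_format, of u v "1/2"] \<open>v \<noteq> u\<close> by simp
  finally show ?thesis by simp
qed

text \<open>
  The graph of the convex subdifferential of \<open>G*\<close> is monotone, that of \<open>F\<close> strictly so; the opposite
  sign of \<open>p\<close> in the two inclusions makes these contradict each other for distinct \<open>u\<close> and \<open>v\<close>.
\<close>

lemma solves_system_unique_primal:
  assumes F: "strictly_convex F"
    and up: "solves_system F G u p" and vq: "solves_system F G v q"
  shows "u = v"
proof (rule ccontr)
  assume "u \<noteq> v"
  let ?H = "fenchel_conjugate G"
  have sub: "u \<in> subdifferential ?H p" "v \<in> subdifferential ?H q"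
    using up vq by (auto simp: solves_system_def)
  then obtain a b where ab: "?H p = ereal a" "?H q = ereal b"
    by (cases "?H p"; cases "?H q") (auto simp: subdifferential_def)
  have "a + u \<bullet> (q - p) \<le> b" "b + v \<bullet> (p - q) \<le> a"
    using sub ab unfolding subdifferential_def
    by (metis (mono_tags, lifting) ereal_less_eq(3) mem_Collect_eq plus_ereal.simps(1))+
  moreover have "F u + - p \<bullet> (v - u) < F v" "F v + - q \<bullet> (u - v) < F u"
    using strictly_convex_subgradient_less[OF F, of "- p" u v]
      strictly_convex_subgradient_less[OF F, of "- q" v u] up vq \<open>u \<noteq> v\<close>
    by (simp_all add: solves_system_def)
  ultimately show False
    by (simp add: inner_diff_left inner_diff_right inner_commute)
qed

text \<open>
  Along every line through \<open>u\<close>, subtracting the linear function given by a subgradient leaves a function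
  with a minimum at \<open>u\<close>, so the subgradient determines the directional derivative.
\<close>

lemma gateaux_differentiable_subgradient_unique:
  assumes F: "gateaux_differentiable_at F u"
    and p: "p \<in> subdifferential (\<lambda>x. ereal (F x)) u"
    and q: "q \<in> subdifferential (\<lambda>x. ereal (F x)) u"
  shows "p = q"
proof -
  have deriv: "D = p \<bullet> h"
    if D: "((\<lambda>t. F (u + t *\<^sub>R h)) has_real_derivative D) (at 0)"
      and p: "p \<in> subdifferential (\<lambda>x. ereal (F x)) u" for D h p
  proof -
    have "((\<lambda>t. F (u + t *\<^sub>R h) - t * (p \<bullet> h)) has_real_derivative D - p \<bullet> h) (at 0)"
      using D by (auto intro!: derivative_eq_intros)
    moreover have "F (u + 0 *\<^sub>R h) - 0 * (p \<bullet> h) \<le> F (u + t *\<^sub>R h) - t * (p \<bullet> h)" for t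
      using p by (auto simp: subdifferential_def dest: spec[of _ "u + t *\<^sub>R h"])
    ultimately have "D - p \<bullet> h = 0"
      using DERIV_local_min[of "\<lambda>t. F (u + t *\<^sub>R h) - t * (p \<bullet> h)" "D - p \<bullet> h" 0 1] by simp
    then show ?thesis by simp
  qed
  have "p \<bullet> h = q \<bullet> h" for h
  proof -
    obtain D where "((\<lambda>t. F (u + t *\<^sub>R h)) has_real_derivative D) (at 0)"
      using F by (auto simp: gateaux_differentiable_at_def real_differentiable_def)
    then show ?thesis using deriv p q by metis
  qed
  then have "(p - q) \<bullet> (p - q) = 0" by (simp add: inner_diff_left)
  then show ?thesis by simp
qed

theorem proposition2p1:
  fixes F :: "'a::{real_inner, complete_space} \<Rightarrow> real"
    and G :: "'a \<Rightarrow> ereal"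
  assumes "convex_on UNIV F"
    and "weakly_lsc F"
    and "proper G"
    and "\<forall>u. 0 \<le> G u"
    and "radially_unbounded (\<lambda>u. ereal (F u) + fenchel_conjugate (fenchel_conjugate G) u)"
  shows "(\<exists>u p. solves_system F G u p) \<and>
    (strictly_convex F \<longrightarrow>
      (\<exists>!u. \<exists>p. solves_system F G u p) \<and>
      (\<forall>u p q. gateaux_differentiable_at F u \<longrightarrow>
         solves_system F G u p \<longrightarrow> solves_system F G u q \<longrightarrow> p = q))"
proof (intro conjI impI)
  show ex: "\<exists>u p. solves_system F G u p"
    using assms by (intro solves_system_exists) auto
  show "\<exists>!u. \<exists>p. solves_system F G u p" if "strictly_convex F"
    using ex solves_system_unique_primal[OF that] by blast
  show "\<forall>u p q. gateaux_differentiable_at F u \<longrightarrow>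
      solves_system F G u p \<longrightarrow> solves_system F G u q \<longrightarrow> p = q"
    using gateaux_differentiable_subgradient_unique unfolding solves_system_def
    by (metis neg_equal_iff_equal)
qed

end
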